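(* Let $1\leq n\leq Q$ be integers and let $k\geq 3$ be an odd integer. The number of tuples of integers $(a_1,\ldots,a_k,q_1,\ldots,q_k)$ with $1\le q_i\leq Q$, $|a_i|\leq n$ and $\gcd(a_i,q_i)=1$ for $1\leq i\leq k$, such that \[\frac{a_1}{q_1}+\cdots+\frac{a_k}{q_k}\in\mathbb{Z},\] is \[\ll_k (\log Q)^{O_k(1)}\, n^{\frac{k+1}{2}}Q^{\frac{k-1}{2}}.\]
   Context: The notation $f\ll_k g$ means $|f|\leq C_k g$ for a constant $C_k$ depending only on $k$; $O_k(1)$ denotes a quantity bounded in terms of $k$ only. *)

theory Defs
  imports Complex_Main "HOL-Library.FuncSet"
begin

text \<open>A \<open>k\<close>-tuple of integers is an extensional function on \<open>{1..k}\<close>, so that counting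
  functions is the same as counting tuples.\<close>

definition integral_sum_tuples :: "nat \<Rightarrow> int \<Rightarrow> int \<Rightarrow> ((nat \<Rightarrow> int) \<times> (nat \<Rightarrow> int)) set" where
  "integral_sum_tuples k n Q =
     {(a, q). a \<in> {1..k} \<rightarrow>\<^sub>E UNIV \<and> q \<in> {1..k} \<rightarrow>\<^sub>E UNIV \<and>
        (\<forall>i\<in>{1..k}. 1 \<le> q i \<and> q i \<le> Q \<and> \<bar>a i\<bar> \<le> n \<and> gcd (a i) (q i) = 1) \<and>
        (\<Sum>i=1..k. real_of_int (a i) / real_of_int (q i)) \<in> \<int>}"

text \<open>By finiteness, \<open>card\<close> really counts these tuples.\<close>

lemma finite_integral_sum_tuples: "finite (integral_sum_tuples k n Q)"
proof (rule finite_subset)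
  show "integral_sum_tuples k n Q \<subseteq>
      ({1..k} \<rightarrow>\<^sub>E {-n..n}) \<times> ({1..k} \<rightarrow>\<^sub>E {1..Q})"
    unfolding integral_sum_tuples_def PiE_iff by (auto simp: abs_le_iff extensional_def)
  show "finite (({1..k} \<rightarrow>\<^sub>E {-n..n}) \<times> ({1..k} \<rightarrow>\<^sub>E {1..Q}))"
    by (intro finite_cartesian_product finite_PiE) auto
qed

end

theory Submission
  imports Defs "HOL-Library.Discrete_Functions"
begin

text \<open>
  Write \<open>k = 2 m + 1\<close> and let \<open>s\<^sub>j\<close> be the denominator of the partial sum
  \<open>a\<^sub>1/q\<^sub>1 + \<dots> + a\<^sub>j/q\<^sub>j\<close>. The ratios \<open>r\<^sub>j = s\<^sub>j/s\<^sub>j\<^sub>-\<^sub>1\<close> lie in \<open>[1/Q, Q]\<close>, and their product is \<open>1\<close> if the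
  total sum is an integer; splitting the indices according to whether \<open>n r\<^sub>j \<ge> 1\<close> gives
  \<open>\<Prod> max(1, n r\<^sub>j) \<le> n\<^bsup>m+1\<^esup> Q\<^bsup>m\<^esup>\<close>. This is where \<open>k\<close> odd enters. Conversely,
  given a partial sum of denominator \<open>s\<close>, the reduced fractions \<open>a/q\<close> that produce a
  ratio of size about \<open>r\<close> number \<open>O(1 + n r)\<close>, up to a factor \<open>\<tau>(s)\<^sup>2 log Q\<close>: after
  fixing \<open>gcd(s, q)\<close> and the cancellation \<open>c\<close>, they become well-spaced points on the line.
  So the sum of \<open>\<Prod> 1/max(1, n r\<^sub>j)\<close> over all tuples is small. The divisor functions are
  harmless on average once the tuple is reordered so that the first denominator has the most
  divisors, because \<open>(a\<^sub>1, q\<^sub>1)\<close> is unconstrained.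
\<close>

section \<open>The divisor function on average\<close>

definition ndivs :: "nat \<Rightarrow> nat" where
  "ndivs n = card {d. d dvd n}"

lemma ndivs_pos: "n > 0 \<Longrightarrow> ndivs n \<ge> 1"
  unfolding ndivs_def by (metis One_nat_def Suc_leI card_gt_0_iff dvd_refl empty_iff finite_divisors_nat mem_Collect_eq)

lemma ndivs_dvd_le: "m dvd n \<Longrightarrow> n > 0 \<Longrightarrow> ndivs m \<le> ndivs n"
  unfolding ndivs_def by (intro card_mono) (auto intro: dvd_trans)

text \<open>Every divisor of a product splits as a divisor of \<open>m\<close> times a divisor of
  \<open>n\<close>, so multiplication maps pairs of divisors onto the divisors of the
  product.\<close>

lemma ndivs_mult_le:
  assumes "m > 0" "n > 0"
  shows "ndivs (m * n) \<le> ndivs m * ndivs n"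
proof -
  have "{d. d dvd m * n} \<subseteq> (\<lambda>(x, y). x * y) ` ({d. d dvd m} \<times> {d. d dvd n})"
  proof
    fix d assume "d \<in> {d. d dvd m * n}"
    then obtain x y where "d = x * y" "x dvd m" "y dvd n"
      using division_decomp[of d m n] by auto
    then show "d \<in> (\<lambda>(x, y). x * y) ` ({d. d dvd m} \<times> {d. d dvd n})"
      by (intro image_eqI[of _ _ "(x, y)"]) auto
  qed
  then have "card {d. d dvd m * n} \<le> card ({d. d dvd m} \<times> {d. d dvd n})"
    using assms by (intro surj_card_le) auto
  then show ?thesis
    by (simp add: ndivs_def card_cartesian_product)
qed

lemma harmonic_sum_le: "Q \<ge> 1 \<Longrightarrow> (\<Sum>q=1..Q. 1 / real q) \<le> 1 + ln (real Q)"
proof (induction Q rule: nat_induct_at_least)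
  case (Suc Q)
  have "1 / real (Suc Q) \<le> ln (real (Suc Q)) - ln (real Q)"
  proof -
    have "ln (real Q / real (Suc Q)) \<le> real Q / real (Suc Q) - 1"
      using Suc by (intro ln_le_minus_one) auto
    also have "real Q / real (Suc Q) - 1 = - (1 / real (Suc Q))"
      by (simp add: field_simps)
    finally show ?thesis
      using Suc by (simp add: ln_div)
  qed
  with Suc show ?case by simp
qed simp

text \<open>One factor \<open>ndivs q\<close> is opened as a sum over factorisations q = d m.
  Submultiplicativity separates d from m, so each further power of \<open>ndivs\<close> squares the
  bound; hence the exponent \<open>2 ^ K\<close>.\<close>

lemma sum_ndivs_power_le:
  assumes "Q \<ge> 1"
  shows "(\<Sum>q=1..Q. real (ndivs q) ^ K / real q) \<le> (1 + ln (real Q)) ^ (2 ^ K)"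
proof (induction K)
  case 0
  then show ?case using harmonic_sum_le[OF assms] by simp
next
  case (Suc K)
  let ?f = "\<lambda>q. real (ndivs q) ^ K / real q"
  have "(\<Sum>q=1..Q. real (ndivs q) ^ Suc K / real q) = (\<Sum>q=1..Q. \<Sum>d\<in>{d. d dvd q}. ?f q)"
    by (simp add: ndivs_def)
  also have "\<dots> = (\<Sum>(q, d)\<in>(SIGMA q:{1..Q}. {d. d dvd q}). ?f q)"
    by (subst sum.Sigma) auto
  \<comment> \<open>Dropping the constraint d m \<le> Q leaves a full square of pairs, over which
    the sum factors.\<close>
  also have "\<dots> \<le> (\<Sum>(d, m)\<in>{1..Q} \<times> {1..Q}. ?f d * ?f m)"
  proof (rule sum_le_included[where i = "\<lambda>(d, m). (d * m, d)"])
    show "\<forall>x\<in>SIGMA q:{1..Q}. {d. d dvd q}. \<exists>y\<in>{1..Q} \<times> {1..Q}.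
        (case y of (d, m) \<Rightarrow> (d * m, d)) = x \<and>
        (case x of (q, d) \<Rightarrow> ?f q) \<le> (case y of (d, m) \<Rightarrow> ?f d * ?f m)"
    proof (safe, goal_cases)
      case (1 q d)
      then obtain m where m: "q = d * m" by (auto elim: dvdE)
      with 1 have pos: "d \<ge> 1" "m \<ge> 1" by (auto simp: Suc_le_eq)
      have "d \<le> d * m" "m \<le> d * m" using pos by auto
      moreover have "d * m \<le> Q" using 1 m by simp
      ultimately have le: "d \<le> Q" "m \<le> Q" by linarith+
      have "real (ndivs q) \<le> real (ndivs d * ndivs m)"
        using ndivs_mult_le pos unfolding m by (simp del: of_nat_mult)
      then have "real (ndivs q) ^ K \<le> real (ndivs d * ndivs m) ^ K"
        by (rule power_mono) simp
      then have "?f q \<le> ?f d * ?f m"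
        using pos unfolding m by (simp add: field_simps power_mult_distrib)
      then show ?case using pos le m
        by (intro bexI[of _ "(d, m)"]) auto
    qed
  qed (auto intro!: divide_nonneg_nonneg mult_nonneg_nonneg)
  also have "\<dots> = (\<Sum>q=1..Q. ?f q) ^ 2"
    by (simp add: power2_eq_square sum_product sum.cartesian_product)
  also have "\<dots> \<le> ((1 + ln (real Q)) ^ (2 ^ K)) ^ 2"
    by (intro power_mono Suc.IH sum_nonneg) auto
  also have "\<dots> = (1 + ln (real Q)) ^ (2 ^ Suc K)"
    by (simp add: power_mult[symmetric] mult.commute)
  finally show ?case .
qed

text \<open>Pigeonhole: cells of length \<open>\<delta>\<close> starting at -M contain at most one
  point of \<open>S\<close> each.\<close>

lemma card_separated_le:
  fixes S :: "real set"
  assumes "finite S" "\<delta> > 0" "M \<ge> 0"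
    and bound: "\<And>x. x \<in> S \<Longrightarrow> \<bar>x\<bar> \<le> M"
    and sep: "\<And>x y. x \<in> S \<Longrightarrow> y \<in> S \<Longrightarrow> x \<noteq> y \<Longrightarrow> \<bar>x - y\<bar> \<ge> \<delta>"
  shows "real (card S) \<le> 1 + 2 * M / \<delta>"
proof -
  let ?f = "\<lambda>x. \<lfloor>(x + M) / \<delta>\<rfloor>"
  have inj: "inj_on ?f S"
  proof (rule inj_onI, rule ccontr)
    fix x y assume xy: "x \<in> S" "y \<in> S" "?f x = ?f y" "x \<noteq> y"
    have "\<bar>(x + M) / \<delta> - (y + M) / \<delta>\<bar> < 1"
      using xy(3) by linarith
    then have "\<bar>x - y\<bar> / \<delta> < 1"
      using \<open>\<delta> > 0\<close> by (simp add: diff_divide_distrib[symmetric])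
    with sep[OF xy(1,2,4)] \<open>\<delta> > 0\<close> show False by simp
  qed
  have "?f ` S \<subseteq> {0..\<lfloor>2 * M / \<delta>\<rfloor>}"
  proof safe
    fix x assume "x \<in> S"
    then have "0 \<le> x + M" "x + M \<le> 2 * M" using bound[of x] by auto
    then show "?f x \<in> {0..\<lfloor>2 * M / \<delta>\<rfloor>}"
      using \<open>\<delta> > 0\<close> by (auto intro!: floor_mono divide_right_mono)
  qed
  then have "card (?f ` S) \<le> card {0..\<lfloor>2 * M / \<delta>\<rfloor>}"
    by (rule card_mono[rotated]) simp
  then have "real (card S) \<le> real (nat (\<lfloor>2 * M / \<delta>\<rfloor> + 1))"
    by (simp add: card_image inj)
  also have "\<dots> \<le> 1 + 2 * M / \<delta>"
    using assms by simp
  finally show ?thesis .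
qed

section \<open>Denominators of sums of fractions\<close>

definition den :: "rat \<Rightarrow> nat" where
  "den \<beta> = nat (snd (quotient_of \<beta>))"

lemma den_eqI:
  assumes "y > 0" "coprime x (int y)"
  shows "den (of_int x / of_nat y) = y"
proof -
  have "quotient_of (Fract x (int y)) = (x, int y)"
    using assms by (simp add: quotient_of_Fract normalize_stable)
  then show ?thesis by (simp add: den_def Fract_of_int_quotient)
qed

lemma den_pos: "den \<beta> > 0"
  by (simp add: den_def quotient_of_denom_pos')

lemma den_cases:
  obtains b where "\<beta> = of_int b / of_nat (den \<beta>)" "coprime b (int (den \<beta>))"
proof -
  obtain b s where bs: "quotient_of \<beta> = (b, s)" by fastforce
  have "s > 0" using quotient_of_denom_pos[OF bs] .
  moreover have "coprime b s" using quotient_of_coprime[OF bs] .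
  moreover have "\<beta> = of_int b / of_int s" using quotient_of_div[OF bs] .
  ultimately show ?thesis using that[of b] bs by (simp add: den_def)
qed

lemma den_of_int: "den (of_int z) = 1"
  using den_eqI[of 1 z] by simp

text \<open>Over the common denominator g s1 q1, the numerator N is coprime to s1 and to q1, so it
  can cancel only against g. The cancelled factor is therefore exactly \<open>c\<close>.\<close>

lemma den_add:
  fixes a b :: int and s q :: nat
  assumes "s > 0" "coprime b (int s)" "q > 0" "coprime a (int q)"
  defines "g \<equiv> gcd s q"
  defines "c \<equiv> gcd (b * int (q div g) + a * int (s div g)) (int g)"
  shows "int (den (of_int b / of_nat s + of_int a / of_nat q)) * c = int s * int (q div g)"
proof -
  define s1 q1 where "s1 = s div g" and "q1 = q div g"
  define N where "N = b * int q1 + a * int s1"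
  have g: "g > 0" using assms by (simp add: g_def)
  have s: "s = g * s1" and q: "q = g * q1" by (simp_all add: s1_def q1_def g_def)
  have pos: "s1 > 0" "q1 > 0" using s q assms(1,3) by (auto intro: gr0I)
  have c_def': "c = gcd N (int g)" by (simp add: c_def N_def s1_def q1_def)
  have "coprime s1 q1"
    unfolding s1_def q1_def g_def using assms by (intro div_gcd_coprime) auto
  then have cop: "coprime (int s1) (int q1)" by simp
  have "coprime b (int s1)" "coprime a (int q1)"
    using assms(2,4) unfolding s q by simp_all
  then have cop': "coprime (b * int q1) (int s1)" "coprime (a * int s1) (int q1)"
    using cop by (auto simp: coprime_commute)
  have N1: "coprime N (int s1)"
  proof (rule coprimeI)
    fix d assume d: "d dvd N" "d dvd int s1"
    then have "d dvd b * int q1" unfolding N_def by (simp add: dvd_add_left_iff)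
    with d(2) cop'(1) show "is_unit d" by (meson coprime_common_divisor)
  qed
  have N2: "coprime N (int q1)"
  proof (rule coprimeI)
    fix d assume d: "d dvd N" "d dvd int q1"
    then have "d dvd a * int s1" unfolding N_def by (simp add: dvd_add_right_iff)
    with d(2) cop'(2) show "is_unit d" by (meson coprime_common_divisor)
  qed
  have cpos: "c > 0" using g by (simp add: c_def')
  \<comment> \<open>Removing \<open>c\<close> from N and from g leaves N' / (g' s1 q1), which is in
    lowest terms.\<close>
  obtain N' where N': "N = c * N'" using c_def' by (metis dvdE gcd_dvd1)
  obtain g' where g': "int g = c * g'" using c_def' by (metis dvdE gcd_dvd2)
  have g'pos: "g' > 0" using g' g cpos by (metis of_nat_0_less_iff zero_less_mult_pos)
  have "coprime N' g'"
  proof -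
    have "N div c = N'" "int g div c = g'" using N' g' cpos by simp_all
    with div_gcd_coprime[of N "int g"] g show ?thesis by (simp add: c_def')
  qed
  moreover have "coprime N' (int s1)" "coprime N' (int q1)" using N1 N2 N' by simp_all
  ultimately have "coprime N' (int (nat g' * s1 * q1))"
    using g'pos by simp
  then have "den (of_int N' / of_nat (nat g' * s1 * q1)) = nat g' * s1 * q1"
    using g'pos pos by (intro den_eqI) auto
  moreover have "of_int b / of_nat s + of_int a / of_nat q = (of_int N' / of_nat (nat g' * s1 * q1) :: rat)"
  proof -
    have "of_int b / of_nat s + of_int a / of_nat q = (of_int N / (of_nat g * of_nat s1 * of_nat q1) :: rat)"
      using g pos unfolding s q N_def by (simp add: field_simps)
    also have "(of_nat g :: rat) = of_int c * of_int g'"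
      using arg_cong[OF g', of "of_int :: int \<Rightarrow> rat"] by simp
    also have "(of_int N / (of_int c * of_int g' * of_nat s1 * of_nat q1) :: rat)
        = of_int N' / of_nat (nat g' * s1 * q1)"
      using cpos g'pos by (simp add: N')
    finally show ?thesis .
  qed
  ultimately show ?thesis
    using g'pos g' unfolding q1_def[symmetric] s by simp
qed

section \<open>Adding one reduced fraction\<close>

definition reduced_fracs :: "nat \<Rightarrow> nat \<Rightarrow> (int \<times> nat) set" where
  "reduced_fracs n Q = {(a, q). \<bar>a\<bar> \<le> int n \<and> 1 \<le> q \<and> q \<le> Q \<and> coprime a (int q)}"

definition frac_val :: "int \<times> nat \<Rightarrow> rat" where
  "frac_val x = of_int (fst x) / of_nat (snd x)"

lemma reduced_fracs_subset: "reduced_fracs n Q \<subseteq> {- int n..int n} \<times> {1..Q}"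
  by (auto simp: reduced_fracs_def)

lemma finite_reduced_fracs: "finite (reduced_fracs n Q)"
  using finite_subset[OF reduced_fracs_subset] by blast

text \<open>Distinct reduced fractions differ by |a q' - a' q| / (q q'), whose numerator is a
  nonzero multiple of \<open>c\<close>. So they are spaced by at least c / (4 X^2), and all lie in
  [-n/X, n/X].\<close>

lemma card_fracs_congruent_le:
  fixes P :: "(int \<times> nat) set" and X c :: nat
  assumes "P \<subseteq> reduced_fracs n Q" "X > 0" "c > 0"
    and X: "\<And>a q. (a, q) \<in> P \<Longrightarrow> X \<le> q \<and> q < 2 * X"
    and cong: "\<And>a q a' q'. (a, q) \<in> P \<Longrightarrow> (a', q') \<in> P \<Longrightarrow> int c dvd a * int q' - a' * int q"
  shows "real (card P) \<le> 1 + 8 * real n * real X / real c"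
proof -
  let ?v = "\<lambda>x :: int \<times> nat. real_of_int (fst x) / real (snd x)"
  have fin: "finite P" using assms(1) finite_reduced_fracs finite_subset by blast
  have sep: "\<bar>?v x - ?v y\<bar> \<ge> real c / (4 * real X ^ 2)"
    if xy: "x \<in> P" "y \<in> P" "x \<noteq> y" for x y
  proof -
    obtain a q a' q' where x: "x = (a, q)" and y: "y = (a', q')" by fastforce
    have q: "q > 0" "q' > 0" "q \<le> 2 * X" "q' \<le> 2 * X" and cop: "coprime a (int q)" "coprime a' (int q')"
      using xy X[of a q] X[of a' q'] assms(1) unfolding x y reduced_fracs_def by auto
    have "a * int q' - a' * int q \<noteq> 0"
    proof
      assume "a * int q' - a' * int q = 0"
      then have "(of_int (a * int q') :: rat) = of_int (a' * int q)" by simp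
      then have eq: "(of_int a / of_nat q :: rat) = of_int a' / of_nat q'"
        using q by (simp add: frac_eq_eq)
      \<comment> \<open>Equal values in lowest terms have equal denominators, and then equal
        numerators.\<close>
      from arg_cong[OF this, of den] have "q = q'"
        using q cop by (simp add: den_eqI)
      with eq q xy(3) show False unfolding x y by simp
    qed
    moreover have "int c dvd a * int q' - a' * int q"
      using cong xy unfolding x y by blast
    ultimately have "int c \<le> \<bar>a * int q' - a' * int q\<bar>"
      using dvd_imp_le_int by (metis abs_of_nat)
    then have "real_of_int (int c) \<le> real_of_int \<bar>a * int q' - a' * int q\<bar>"
      by (simp only: of_int_le_iff)
    then have c: "real c \<le> \<bar>real_of_int a * real q' - real_of_int a' * real q\<bar>"
      by simp
    have "real q * real q' \<le> (2 * real X) * (2 * real X)"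
      using q by (intro mult_mono) (simp_all flip: of_nat_mult)
    then have qq: "real q * real q' \<le> 4 * real X ^ 2" by (simp add: power2_eq_square)
    have "real c / (4 * real X ^ 2) \<le> real c / (real q * real q')"
      using q qq by (intro divide_left_mono) auto
    also have "\<dots> \<le> \<bar>real_of_int a * real q' - real_of_int a' * real q\<bar> / (real q * real q')"
      using c q by (intro divide_right_mono) auto
    also have "\<dots> = \<bar>?v x - ?v y\<bar>"
      using q by (simp add: x y diff_frac_eq abs_divide abs_mult)
    finally show ?thesis .
  qed
  have \<delta>: "real c / (4 * real X ^ 2) > 0" using assms by simp
  have inj: "inj_on ?v P"
    using sep \<delta> by (intro inj_onI) (metis abs_zero diff_self not_le)
  have "real (card (?v ` P)) \<le> 1 + 2 * (real n / real X) / (real c / (4 * real X ^ 2))"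
  proof (rule card_separated_le)
    fix r assume "r \<in> ?v ` P"
    then obtain a q where aq: "(a, q) \<in> P" "r = real_of_int a / real q" by auto
    then have "\<bar>a\<bar> \<le> int n" "X \<le> q" using assms(1) X unfolding reduced_fracs_def by auto
    then have "\<bar>real_of_int a\<bar> \<le> real n" "real X \<le> real q" by linarith+
    then show "\<bar>r\<bar> \<le> real n / real X"
      using \<open>X > 0\<close> unfolding aq(2) abs_divide by (intro frac_le) auto
  qed (use fin \<delta> sep in auto)
  also have "\<dots> = 1 + 8 * real n * real X / real c"
    using assms by (simp add: field_simps power2_eq_square)
  finally show ?thesis by (simp add: card_image inj)
qed

text \<open>The ratio r of one step; along a list these telescope to the last denominator over the
  first.\<close>

definition den_ratio :: "rat \<Rightarrow> int \<times> nat \<Rightarrow> real" where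
  "den_ratio \<beta> x = real (den (\<beta> + frac_val x)) / real (den \<beta>)"

text \<open>By \<open>den_add\<close> the ratio is (q/g)/c, where g = gcd(s, q) and c divides g,
  hence s. Fixing g, c and the dyadic size of q/g gives at most
  \<open>ndivs s ^ 2 * (floor_log Q + 1)\<close> classes. In each, the number of fractions is
  balanced by the weight, so a class contributes at most 9.\<close>

lemma sum_step_le:
  "(\<Sum>x\<in>reduced_fracs n Q. 1 / max 1 (real n * den_ratio \<beta> x))
          \<le> 9 * real (floor_log Q + 1) * real (ndivs (den \<beta>)) ^ 2"
proof -
  obtain b where b: "\<beta> = of_int b / of_nat (den \<beta>)" "coprime b (int (den \<beta>))"
    by (rule den_cases)
  define s where "s = den \<beta>"
  have s: "s > 0" by (simp add: s_def den_pos)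
  have cop_b: "coprime b (int s)" using b s_def by simp
  define g where "g x = gcd s (snd x)" for x :: "int \<times> nat"
  define q1 where "q1 x = snd x div g x" for x
  define c where "c x = nat (gcd (b * int (q1 x) + fst x * int (s div g x)) (int (g x)))" for x
  define cls where "cls x = (g x, c x, floor_log (q1 x))" for x
  let ?A = "reduced_fracs n Q" and ?w = "\<lambda>x. 1 / max 1 (real n * den_ratio \<beta> x)"
  let ?I = "{d. d dvd s} \<times> {d. d dvd s} \<times> {..floor_log Q}"
  have g: "g x > 0" "g x dvd s" "g x dvd snd x" for x using s by (auto simp: g_def)
  have c: "c x > 0" "c x dvd g x" for x
  proof -
    show "c x > 0" using g[of x] by (simp add: c_def)
    have "int (c x) dvd int (g x)" by (simp add: c_def)
    then show "c x dvd g x" by simp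
  qed
  have c_dvd: "int (c x) dvd b * int (q1 x) + fst x * int (s div g x)" for x
    by (simp add: c_def)
  have q1: "q1 x > 0" "q1 x \<le> Q" if "x \<in> ?A" for x
  proof -
    have "snd x > 0" "snd x \<le> Q" using that by (auto simp: reduced_fracs_def)
    then show "q1 x > 0" "q1 x \<le> Q"
      using g[of x] unfolding q1_def
      by (auto intro: order.trans[OF div_le_dividend] simp: div_greater_zero_iff dvd_imp_le)
  qed
  have ratio: "den_ratio \<beta> x = real (q1 x) / real (c x)" if "x \<in> ?A" for x
  proof -
    have "int (den (of_int b / of_nat s + of_int (fst x) / of_nat (snd x))) * int (c x) = int s * int (q1 x)"
      using den_add[of s b "snd x" "fst x"] that s cop_b
      by (auto simp: reduced_fracs_def c_def q1_def g_def)
    then have "den (\<beta> + frac_val x) * c x = s * q1 x"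
      using b(1) unfolding frac_val_def s_def by (simp flip: of_nat_mult)
    then have "real (den (\<beta> + frac_val x)) * real (c x) = real s * real (q1 x)"
      by (simp flip: of_nat_mult)
    then show ?thesis
      using s c[of x] unfolding den_ratio_def s_def[symmetric] by (simp add: field_simps)
  qed
  have fibre: "(\<Sum>x | x \<in> ?A \<and> cls x = i. ?w x) \<le> 9" if "i \<in> cls ` ?A" for i
  proof -
    obtain g0 c0 e where i: "i = (g0, c0, e)" by (cases i) auto
    let ?P = "{x \<in> ?A. cls x = i}" and ?y = "real n * 2 ^ e / real c0"
    have c0: "c0 > 0" using that c(1) by (auto simp: i cls_def)
    have fin: "finite ?P" by (simp add: finite_reduced_fracs)
    have Pq: "2 ^ e \<le> q1 x" "q1 x < 2 * 2 ^ e" if "x \<in> ?P" for x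
      using that floor_log_exp2_le[of "q1 x"] floor_log_exp2_gt[of "q1 x"] q1[of x]
      by (auto simp: i cls_def)
    \<comment> \<open>The spacing argument is applied to a/(q/g) instead of a/q. No fraction is
      lost, since g is constant on the class.\<close>
    let ?r = "\<lambda>x :: int \<times> nat. (fst x, q1 x)"
    have inj: "inj_on ?r ?P"
    proof (rule inj_onI)
      fix x y assume "x \<in> ?P" "y \<in> ?P" "?r x = ?r y"
      then have "fst x = fst y" "snd x div g0 = snd y div g0" "g0 dvd snd x" "g0 dvd snd y"
        using g(3)[of x] g(3)[of y] by (auto simp: i cls_def q1_def)
      then show "x = y" by (metis dvd_mult_div_cancel prod_eqI)
    qed
    have "real (card (?r ` ?P)) \<le> 1 + 8 * real n * real (2 ^ e) / real c0"
    proof (rule card_fracs_congruent_le)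
      show "?r ` ?P \<subseteq> reduced_fracs n Q"
      proof safe
        fix a q assume x: "(a, q) \<in> ?A"
        have "int (q1 (a, q)) dvd int q"
          using g(3)[of "(a, q)"] unfolding q1_def by (metis dvd_div_mult_self dvd_triv_left of_nat_dvd_iff snd_conv)
        then have "coprime a (int (q1 (a, q)))"
          using x coprime_divisors[of a a "int (q1 (a, q))" "int q"] by (simp add: reduced_fracs_def)
        then show "?r (a, q) \<in> ?A"
          using x q1[OF x] by (simp add: reduced_fracs_def)
      qed
      show "2 ^ e \<le> q \<and> q < 2 * 2 ^ e" if "(a, q) \<in> ?r ` ?P" for a q
        using that Pq by auto
      show "int c0 dvd a * int q' - a' * int q" if aq: "(a, q) \<in> ?r ` ?P" "(a', q') \<in> ?r ` ?P" for a q a' q'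
      proof -
        obtain x where x: "x \<in> ?P" "a = fst x" "q = q1 x" using aq(1) by auto
        obtain x' where x': "x' \<in> ?P" "a' = fst x'" "q' = q1 x'" using aq(2) by auto
        let ?s1 = "int (s div g0)"
        have "int c0 dvd b * int q + a * ?s1" "int c0 dvd b * int q' + a' * ?s1"
          using x x' c_dvd[of x] c_dvd[of x'] by (auto simp: i cls_def)
        \<comment> \<open>Eliminating s/g between the two congruences leaves b (a q' - a' q), and b
          is coprime to \<open>c0\<close> because \<open>c0\<close> divides s.\<close>
        then have "int c0 dvd a * (b * int q' + a' * ?s1) - a' * (b * int q + a * ?s1)"
          by (intro dvd_diff dvd_mult)
        also have "\<dots> = b * (a * int q' - a' * int q)" by (simp add: algebra_simps)
        finally have "int c0 dvd b * (a * int q' - a' * int q)" .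
        moreover have "coprime (int c0) b"
        proof -
          have "c0 dvd s" using x(1) c(2)[of x] g(2)[of x] by (auto simp: i cls_def intro: dvd_trans)
          then have "int c0 dvd int s" by simp
          then show ?thesis using cop_b by (meson coprime_commute coprime_divisors dvd_refl)
        qed
        ultimately show ?thesis by (simp add: coprime_dvd_mult_right_iff)
      qed
    qed (use c0 in auto)
    then have card_P: "real (card ?P) \<le> 1 + 8 * ?y" by (simp add: card_image inj)
    have "?w x \<le> 1 / max 1 ?y" if x: "x \<in> ?P" for x
    proof -
      have "c x = c0" using x by (simp add: i cls_def)
      have "(2::real) ^ e \<le> real (q1 x)"
        using Pq(1)[OF x] by (metis of_nat_le_iff of_nat_numeral of_nat_power)
      then have "?y \<le> real n * den_ratio \<beta> x"
        using x ratio[of x] \<open>c x = c0\<close> by (simp add: divide_right_mono mult_left_mono)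
      then show ?thesis by (intro divide_left_mono) auto
    qed
    then have "(\<Sum>x\<in>?P. ?w x) \<le> real (card ?P) * (1 / max 1 ?y)"
      by (rule sum_bounded_above)
    also have "\<dots> \<le> (1 + 8 * ?y) * (1 / max 1 ?y)"
      using card_P by (rule mult_right_mono) (simp add: le_max_iff_disj)
    \<comment> \<open>Both 1 and y are at most \<open>max 1 y\<close>, so 1 + 8 y is at most 9 times
      it.\<close>
    also have "(1 + 8 * y) * (1 / max 1 y) \<le> 9" for y :: real
      by (simp add: divide_le_eq max_def)
    then have "(1 + 8 * ?y) * (1 / max 1 ?y) \<le> 9" .
    finally show ?thesis by simp
  qed
  have cls: "cls ` ?A \<subseteq> ?I"
    using q1 g(2) dvd_trans[OF c(2) g(2)] by (auto simp: cls_def intro: floor_log_le_iff)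
  have "(\<Sum>x\<in>?A. ?w x) = (\<Sum>i\<in>cls ` ?A. \<Sum>x | x \<in> ?A \<and> cls x = i. ?w x)"
    by (rule sum.image_gen) (rule finite_reduced_fracs)
  also have "\<dots> \<le> real (card (cls ` ?A)) * 9"
    by (rule sum_bounded_above) (rule fibre)
  also have "card (cls ` ?A) \<le> card ?I"
    using s by (intro card_mono cls) auto
  also have "card ?I = ndivs s * (ndivs s * (floor_log Q + 1))"
    by (simp add: card_cartesian_product ndivs_def)
  finally show ?thesis by (simp add: s_def power2_eq_square algebra_simps)
qed

section \<open>How far one fraction can change a denominator\<close>

lemma den_dvd:
  assumes "y > 0"
  shows "den (of_int x / of_nat y) dvd y"
proof -
  let ?d = "den (of_int x / of_nat y)"
  obtain b where b: "of_int x / of_nat y = (of_int b / of_nat ?d :: rat)" "coprime b (int ?d)"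
    by (rule den_cases)
  then have "(of_int (x * int ?d) :: rat) = of_int (b * int y)"
    using assms den_pos[of "of_int x / of_nat y"] by (simp add: frac_eq_eq)
  then have "x * int ?d = b * int y" by (simp only: of_int_eq_iff)
  then have "int ?d dvd b * int y" by (metis dvd_triv_right)
  then show ?thesis using b(2) by (simp add: coprime_commute coprime_dvd_mult_right_iff)
qed

lemma den_add_dvd:
  assumes "q > 0"
  shows "den (\<beta> + of_int a / of_nat q) dvd den \<beta> * q"
proof -
  obtain b where b: "\<beta> = of_int b / of_nat (den \<beta>)" by (rule den_cases)
  have "of_int b / of_nat (den \<beta>) + of_int a / of_nat q
      = (of_int (b * int q + a * int (den \<beta>)) / of_nat (den \<beta> * q) :: rat)"
    using assms den_pos[of \<beta>] by (simp add: add_frac_eq)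
  then show ?thesis
    using den_dvd[of "den \<beta> * q"] b assms den_pos[of \<beta>] by (metis nat_0_less_mult_iff)
qed

lemma ndivs_den_add_le:
  assumes "x \<in> reduced_fracs n Q"
  shows "ndivs (den (\<beta> + frac_val x)) \<le> ndivs (den \<beta>) * ndivs (snd x)"
proof -
  have q: "snd x > 0" using assms by (auto simp: reduced_fracs_def)
  have "ndivs (den (\<beta> + frac_val x)) \<le> ndivs (den \<beta> * snd x)"
    using den_add_dvd[OF q] q den_pos by (intro ndivs_dvd_le) (auto simp: frac_val_def)
  also have "\<dots> \<le> ndivs (den \<beta>) * ndivs (snd x)"
    using q den_pos by (intro ndivs_mult_le)
  finally show ?thesis .
qed

text \<open>The new denominator divides the old one times q. Since a step is undone by adding -a/q,
  the old one also divides the new one times q.\<close>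

lemma den_ratio_bounds:
  assumes "x \<in> reduced_fracs n Q"
  shows "den_ratio \<beta> x \<le> real Q" "1 \<le> real Q * den_ratio \<beta> x"
proof -
  let ?s = "den \<beta>" and ?s' = "den (\<beta> + frac_val x)"
  have q: "snd x > 0" "snd x \<le> Q" using assms by (auto simp: reduced_fracs_def)
  have pos: "?s > 0" "?s' > 0" by (simp_all add: den_pos)
  have "?s' dvd ?s * snd x" using den_add_dvd[OF q(1)] by (simp add: frac_val_def)
  then have "?s' \<le> ?s * snd x" using pos q by (intro dvd_imp_le) auto
  also have "\<dots> \<le> ?s * Q" using q by simp
  finally have "real ?s' \<le> real ?s * real Q" by (simp flip: of_nat_mult)
  then show "den_ratio \<beta> x \<le> real Q"
    using pos by (simp add: den_ratio_def divide_le_eq mult.commute)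
  have "?s dvd ?s' * snd x"
    using den_add_dvd[OF q(1), of "\<beta> + frac_val x" "- fst x"] by (simp add: frac_val_def)
  then have "?s \<le> ?s' * snd x" using pos q by (intro dvd_imp_le) auto
  also have "\<dots> \<le> ?s' * Q" using q by simp
  finally have "real ?s \<le> real ?s' * real Q" by (simp flip: of_nat_mult)
  then show "1 \<le> real Q * den_ratio \<beta> x"
    using pos by (simp add: den_ratio_def le_divide_eq mult.commute)
qed

section \<open>Lists of fractions with integral sum\<close>

text \<open>The factors mirror the count O(1 + n r) of fractions with ratio about r, so that
  reciprocals of costs have a small sum. The start \<beta> is a parameter because it moves along the
  list.\<close>

fun path_cost :: "nat \<Rightarrow> rat \<Rightarrow> (int \<times> nat) list \<Rightarrow> real" where
  "path_cost n \<beta> [] = 1"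
| "path_cost n \<beta> (x # xs) = max 1 (real n * den_ratio \<beta> x) * path_cost n (\<beta> + frac_val x) xs"

lemma path_cost_ge_1: "path_cost n \<beta> xs \<ge> 1"
proof (induction xs arbitrary: \<beta>)
  case (Cons x xs)
  then show ?case
    using mult_mono[of 1 "max 1 (real n * den_ratio \<beta> x)" 1 "path_cost n (\<beta> + frac_val x) xs"] by simp
qed simp

text \<open>Here p counts the steps with n r \<ge> 1; the others cost 1. The first bound uses r
  \<le> Q at those p steps. For the second, the product of their ratios is the total ratio divided
  by the remaining ratios, each at least 1/Q.\<close>

lemma path_cost_le:
  assumes "set xs \<subseteq> reduced_fracs n Q"
  shows "\<exists>p\<le>length xs. path_cost n \<beta> xs \<le> real n ^ p * real Q ^ p \<and>
           path_cost n \<beta> xs \<le> real n ^ p * real Q ^ (length xs - p)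
             * (real (den (\<beta> + sum_list (map frac_val xs))) / real (den \<beta>))"
  using assms
proof (induction xs arbitrary: \<beta>)
  case Nil
  then show ?case using den_pos[of \<beta>] by simp
next
  case (Cons x xs)
  let ?r = "den_ratio \<beta> x" and ?c = "path_cost n (\<beta> + frac_val x) xs"
  define R where "R = real (den (\<beta> + sum_list (map frac_val (x # xs)))) / real (den (\<beta> + frac_val x))"
  obtain p where p: "p \<le> length xs" "?c \<le> real n ^ p * real Q ^ p"
      "?c \<le> real n ^ p * real Q ^ (length xs - p) * R"
    using Cons.IH[of "\<beta> + frac_val x"] Cons.prems by (auto simp: R_def add.assoc)
  have r: "?r \<le> real Q" "1 \<le> real Q * ?r"
    using den_ratio_bounds[of x n Q \<beta>] Cons.prems by auto
  have R: "R \<ge> 0" by (simp add: R_def)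
  have rR: "real (den (\<beta> + sum_list (map frac_val (x # xs)))) / real (den \<beta>) = ?r * R"
    using den_pos[of "\<beta> + frac_val x"] by (simp add: R_def den_ratio_def)
  have c0: "?c \<ge> 0" using path_cost_ge_1[of n "\<beta> + frac_val x" xs] by linarith
  show ?case
  proof (cases "real n * ?r \<ge> 1")
    case True
    have "path_cost n \<beta> (x # xs) = (real n * ?r) * ?c" using True by simp
    moreover have "(real n * ?r) * ?c \<le> (real n * real Q) * (real n ^ p * real Q ^ p)"
      using r p(2) c0 True by (intro mult_mono mult_left_mono) auto
    moreover have "(real n * ?r) * ?c \<le> (real n * ?r) * (real n ^ p * real Q ^ (length xs - p) * R)"
      using p(3) True by (intro mult_left_mono) auto
    ultimately show ?thesis
      using p(1) unfolding rR by (intro exI[of _ "Suc p"]) (auto simp: mult_ac)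
  next
    case False
    then have eq: "path_cost n \<beta> (x # xs) = ?c" by simp
    \<comment> \<open>This step costs nothing, but its ratio must enter the total: multiplying by Q
      r \<ge> 1 supplies it at the price of one factor Q.\<close>
    have "?c \<le> (real n ^ p * real Q ^ (length xs - p) * R) * (real Q * ?r)"
      using p(3) mult_left_mono[OF r(2), of "real n ^ p * real Q ^ (length xs - p) * R"] R by simp
    moreover have "length (x # xs) - p = Suc (length xs - p)" using p(1) by simp
    ultimately show ?thesis
      using p(1,2) unfolding rR eq by (intro exI[of _ p]) (auto simp: mult_ac)
  qed
qed

text \<open>The sums start and end at denominator 1, so the total ratio is 1. As the length is odd,
  either p \<le> m and the first bound suffices, or p \<ge> m + 1 and the second does, the surplus
  factors n being replaced by Q.\<close>

lemma closed_path_cost_le: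
  assumes "set xs \<subseteq> reduced_fracs n Q" "length xs = 2 * m + 1" "n \<ge> 1" "n \<le> Q"
    and "sum_list (map frac_val xs) \<in> \<int>"
  shows "path_cost n 0 xs \<le> real n ^ (m + 1) * real Q ^ m"
proof -
  obtain z where z: "sum_list (map frac_val xs) = of_int z" using assms(5) by (auto elim: Ints_cases)
  obtain p where p: "p \<le> 2 * m + 1" "path_cost n 0 xs \<le> real n ^ p * real Q ^ p"
      "path_cost n 0 xs \<le> real n ^ p * real Q ^ (2 * m + 1 - p)"
    using path_cost_le[OF assms(1), of 0] z assms(2) den_of_int[of z] den_of_int[of 0] by auto
  have n1: "real n \<ge> 1" "real Q \<ge> 1" "real n \<le> real Q" using assms by simp_all
  show ?thesis
  proof (cases "p \<le> m")
    case True
    have "real n ^ p * real Q ^ p \<le> real n ^ (m + 1) * real Q ^ m"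
      using n1 True by (intro mult_mono power_increasing) auto
    with p(2) show ?thesis by linarith
  next
    case False
    then obtain d where d: "p = m + 1 + d" using le_Suc_ex[of "m + 1" p] by auto
    then have md: "m = (2 * m + 1 - p) + d" using p(1) by simp
    have "real n ^ p * real Q ^ (2 * m + 1 - p) = real n ^ (m + 1) * (real n ^ d * real Q ^ (2 * m + 1 - p))"
      by (simp add: d power_add)
    also have "\<dots> \<le> real n ^ (m + 1) * (real Q ^ d * real Q ^ (2 * m + 1 - p))"
      using n1 by (intro mult_left_mono mult_right_mono power_mono) auto
    also have "real Q ^ d * real Q ^ (2 * m + 1 - p) = real Q ^ m"
      using md by (metis add.commute power_add)
    finally show ?thesis using p(3) by linarith
  qed
qed

section \<open>Summing reciprocal costs over lists\<close>

lemma sum_lists_Suc: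
  fixes f :: "'a list \<Rightarrow> real"
  assumes "finite B"
  shows "(\<Sum>xs | set xs \<subseteq> B \<and> length xs = Suc j. f xs)
       = (\<Sum>x\<in>B. \<Sum>xs | set xs \<subseteq> B \<and> length xs = j. f (x # xs))"
proof -
  have "(\<Sum>xs | set xs \<subseteq> B \<and> length xs = Suc j. f xs)
      = (\<Sum>(x, xs)\<in>B \<times> {xs. set xs \<subseteq> B \<and> length xs = j}. f (x # xs))"
    by (rule sum.reindex_bij_witness[of _ "\<lambda>(x, xs). x # xs" "\<lambda>xs. (hd xs, tl xs)"])
       (auto simp: length_Suc_conv)
  then show ?thesis by (simp add: sum.cartesian_product)
qed

text \<open>Each step multiplies the divisor count of the current denominator by at most D. The
  budget \<open>i + j \<le> K\<close> keeps it below D^K throughout, so \<open>sum_step_le\<close>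
  yields the same factor at every step.\<close>

lemma sum_path_cost_le:
  fixes n Q D :: nat
  assumes "D \<ge> 1"
  defines "B \<equiv> {x \<in> reduced_fracs n Q. ndivs (snd x) \<le> D}"
  assumes "ndivs (den \<beta>) \<le> D ^ i" "i + j \<le> K"
  shows "(\<Sum>xs | set xs \<subseteq> B \<and> length xs = j. 1 / path_cost n \<beta> xs)
         \<le> (9 * real (floor_log Q + 1) * real D ^ (2 * K)) ^ j"
  using assms(3,4)
proof (induction j arbitrary: \<beta> i)
  case 0
  have "{xs. xs = [] \<and> set xs \<subseteq> B} = {[]}" by auto
  then show ?case by (simp add: conj_commute cong: conj_cong)
next
  case (Suc j)
  let ?E = "9 * real (floor_log Q + 1) * real D ^ (2 * K)"
  let ?w = "\<lambda>x. 1 / max 1 (real n * den_ratio \<beta> x)"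
  have fin: "finite B" by (simp add: B_def finite_reduced_fracs)
  have "(\<Sum>xs | set xs \<subseteq> B \<and> length xs = Suc j. 1 / path_cost n \<beta> xs)
      = (\<Sum>x\<in>B. ?w x * (\<Sum>xs | set xs \<subseteq> B \<and> length xs = j. 1 / path_cost n (\<beta> + frac_val x) xs))"
    by (simp add: sum_lists_Suc[OF fin] sum_distrib_left)
  also have "\<dots> \<le> (\<Sum>x\<in>B. ?w x * ?E ^ j)"
  proof (intro sum_mono mult_left_mono)
    fix x assume x: "x \<in> B"
    then have "ndivs (den (\<beta> + frac_val x)) \<le> ndivs (den \<beta>) * ndivs (snd x)"
      by (intro ndivs_den_add_le[of x n Q]) (simp add: B_def)
    also have "\<dots> \<le> D ^ i * D"
      using Suc.prems x by (intro mult_mono) (auto simp: B_def)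
    finally have "ndivs (den (\<beta> + frac_val x)) \<le> D ^ Suc i" by (simp add: mult.commute)
    then show "(\<Sum>xs | set xs \<subseteq> B \<and> length xs = j. 1 / path_cost n (\<beta> + frac_val x) xs) \<le> ?E ^ j"
      using Suc.prems by (intro Suc.IH[of _ "Suc i"]) auto
  qed (simp add: le_max_iff_disj)
  also have "\<dots> = (\<Sum>x\<in>B. ?w x) * ?E ^ j" by (simp add: sum_distrib_right)
  also have "\<dots> \<le> ?E * ?E ^ j"
  proof (rule mult_right_mono)
    have "(\<Sum>x\<in>B. ?w x) \<le> (\<Sum>x\<in>reduced_fracs n Q. ?w x)"
      by (intro sum_mono2 finite_reduced_fracs) (auto simp: B_def le_max_iff_disj)
    also have "\<dots> \<le> 9 * real (floor_log Q + 1) * real (ndivs (den \<beta>)) ^ 2"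
      by (rule sum_step_le)
    also have "\<dots> \<le> ?E"
    proof (rule mult_left_mono)
      have "ndivs (den \<beta>) \<le> D ^ K"
        using Suc.prems \<open>D \<ge> 1\<close> by (meson add_leD1 order.trans power_increasing)
      then have "ndivs (den \<beta>) ^ 2 \<le> (D ^ K) ^ 2" by (rule power_mono) simp
      also have "(D ^ K) ^ 2 = D ^ (2 * K)" by (simp add: power_mult[symmetric] mult.commute)
      finally show "real (ndivs (den \<beta>)) ^ 2 \<le> real D ^ (2 * K)" by (simp flip: of_nat_power)
    qed simp
    finally show "(\<Sum>x\<in>B. ?w x) \<le> ?E" .
  qed simp
  finally show ?case by simp
qed

section \<open>Counting lists with integral sum\<close>

lemma floor_log_le_ln:
  assumes "Q \<ge> 1"
  shows "real (floor_log Q + 1) \<le> 2 * (1 + ln (real Q))"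
proof -
  have "real (floor_log Q) * ln 2 = ln (real (2 ^ floor_log Q))" by (simp add: ln_realpow)
  also have "\<dots> \<le> ln (real Q)"
    using assms floor_log_exp2_le[of Q] by (subst ln_le_cancel_iff) (auto simp flip: of_nat_le_iff)
  finally have "real (floor_log Q) * ln 2 \<le> ln (real Q)" .
  \<comment> \<open>The bound ln 2 \<ge> 1/2 is ln x \<le> x - 1 at x = 1/2.\<close>
  moreover have "real (floor_log Q) * (1 / 2) \<le> real (floor_log Q) * ln 2"
    using ln_le_minus_one[of "1 / 2"] by (intro mult_left_mono) (simp_all add: ln_div)
  ultimately show ?thesis by simp
qed

text \<open>With the most divisible denominator in front, its divisor count controls all later ones,
  and the outer sum over the free first fraction averages it.\<close>

definition closed_paths :: "nat \<Rightarrow> nat \<Rightarrow> nat \<Rightarrow> (int \<times> nat) list set" where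
  "closed_paths k n Q = {xs. length xs = k \<and> set xs \<subseteq> reduced_fracs n Q \<and>
     (\<forall>x\<in>set xs. ndivs (snd x) \<le> ndivs (snd (hd xs))) \<and> sum_list (map frac_val xs) \<in> \<int>}"

lemma finite_closed_paths: "finite (closed_paths k n Q)"
  by (rule finite_subset[OF _ finite_lists_length_eq[OF finite_reduced_fracs[of n Q], of k]])
    (auto simp: closed_paths_def)

text \<open>Rankin's trick: every closed list has cost at most T, so it is counted with weight T /
  cost. Integrality of the sum can then be forgotten, and the tail is summed for each fixed
  head.\<close>

lemma card_closed_paths_le:
  assumes "n \<ge> 1" "n \<le> Q" "k = 2 * m + 1"
  shows "real (card (closed_paths k n Q))
    \<le> 3 * 18 ^ (2 * m) * (1 + ln (real Q)) ^ (2 * m + 2 ^ (4 * m * k))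
        * real n ^ (m + 1) * real Q ^ m"
proof -
  let ?A = "reduced_fracs n Q" and ?T = "real n ^ (m + 1) * real Q ^ m"
  let ?l = "1 + ln (real Q)"
  define B where "B x = {y \<in> ?A. ndivs (snd y) \<le> ndivs (snd x)}" for x :: "int \<times> nat"
  \<comment> \<open>The 18 is the 9 of \<open>sum_step_le\<close> times the 2 of
    \<open>floor_log_le_ln\<close>.\<close>
  define E where "E q = (18 * ?l * real (ndivs q) ^ (2 * k)) ^ (2 * m)" for q
  have l1: "?l \<ge> 1" using assms by simp
  have E_eq: "E q = (18 * ?l) ^ (2 * m) * real (ndivs q) ^ (4 * m * k)" for q
    unfolding E_def power_mult_distrib by (simp add: mult_ac flip: power_mult)
  have E0: "E q \<ge> 0" for q using l1 by (simp add: E_def)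
  have fin: "finite {xs. set xs \<subseteq> B x \<and> length xs = j}" for x j
    by (rule finite_lists_length_eq) (simp add: B_def finite_reduced_fracs)
  have "real (card (closed_paths k n Q)) = (\<Sum>xs\<in>closed_paths k n Q. 1)" by simp
  also have "\<dots> \<le> (\<Sum>xs\<in>closed_paths k n Q. ?T * (1 / path_cost n 0 xs))"
  proof (rule sum_mono)
    fix xs assume "xs \<in> closed_paths k n Q"
    then have "path_cost n 0 xs \<le> ?T"
      using assms by (intro closed_path_cost_le) (auto simp: closed_paths_def)
    then show "1 \<le> ?T * (1 / path_cost n 0 xs)"
      using path_cost_ge_1[of n 0 xs] by (simp add: le_divide_eq)
  qed
  also have "\<dots> = ?T * (\<Sum>xs\<in>closed_paths k n Q. 1 / path_cost n 0 xs)"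
    by (simp only: sum_distrib_left)
  also have "\<dots> \<le> ?T * (\<Sum>(x, ys)\<in>(SIGMA x:?A. {ys. set ys \<subseteq> B x \<and> length ys = 2 * m}).
      1 / path_cost n 0 (x # ys))"
  proof (intro mult_left_mono sum_le_included[where i = "\<lambda>(x, ys). x # ys"])
    show "\<forall>xs\<in>closed_paths k n Q. \<exists>y\<in>SIGMA x:?A. {ys. set ys \<subseteq> B x \<and> length ys = 2 * m}.
        (case y of (x, ys) \<Rightarrow> x # ys) = xs \<and>
        1 / path_cost n 0 xs \<le> (case y of (x, ys) \<Rightarrow> 1 / path_cost n 0 (x # ys))"
    proof
      fix xs assume xs: "xs \<in> closed_paths k n Q"
      then obtain x ys where "xs = x # ys"
        using assms(3) by (cases xs) (auto simp: closed_paths_def)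
      then show "\<exists>y\<in>SIGMA x:?A. {ys. set ys \<subseteq> B x \<and> length ys = 2 * m}.
        (case y of (x, ys) \<Rightarrow> x # ys) = xs \<and>
        1 / path_cost n 0 xs \<le> (case y of (x, ys) \<Rightarrow> 1 / path_cost n 0 (x # ys))"
        using xs assms(3) by (intro bexI[of _ "(x, ys)"]) (auto simp: closed_paths_def B_def)
    qed
    show "\<forall>y\<in>SIGMA x:?A. {ys. set ys \<subseteq> B x \<and> length ys = 2 * m}.
        0 \<le> (case y of (x, ys) \<Rightarrow> 1 / path_cost n 0 (x # ys))"
    proof safe
      fix a q ys
      show "0 \<le> 1 / path_cost n 0 ((a, q) # ys)"
        using path_cost_ge_1[of n 0 "(a, q) # ys"] by (simp del: path_cost.simps)
    qed
  qed (simp_all add: finite_closed_paths finite_reduced_fracs fin)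
  also have "\<dots> = ?T * (\<Sum>x\<in>?A. \<Sum>ys | set ys \<subseteq> B x \<and> length ys = 2 * m. 1 / path_cost n 0 (x # ys))"
    by (subst sum.Sigma) (auto simp: finite_reduced_fracs fin)
  also have "\<dots> \<le> ?T * (\<Sum>x\<in>?A. 1 / (real n * real (snd x)) * E (snd x))"
  proof (intro mult_left_mono sum_mono)
    fix x assume x: "x \<in> ?A"
    then have q: "snd x > 0" "snd x \<le> Q" "coprime (fst x) (int (snd x))"
      by (auto simp: reduced_fracs_def)
    have d: "den (frac_val x) = snd x" using den_eqI[OF q(1,3)] by (simp add: frac_val_def)
    \<comment> \<open>The first step goes from denominator 1 to q, so it costs n q; its reciprocal
      provides the 1/q of the divisor average.\<close>
    have r: "den_ratio 0 x = real (snd x)" using d den_of_int[of 0] by (simp add: den_ratio_def)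
    have D: "ndivs (snd x) \<ge> 1" using q by (intro ndivs_pos)
    have "real n * real (snd x) \<ge> 1 * 1" using q assms by (intro mult_mono) auto
    then have "(\<Sum>ys | set ys \<subseteq> B x \<and> length ys = 2 * m. 1 / path_cost n 0 (x # ys))
        = 1 / (real n * real (snd x)) * (\<Sum>ys | set ys \<subseteq> B x \<and> length ys = 2 * m. 1 / path_cost n (frac_val x) ys)"
      by (simp add: sum_distrib_left r)
    also have "\<dots> \<le> 1 / (real n * real (snd x)) * (9 * real (floor_log Q + 1) * real (ndivs (snd x)) ^ (2 * k)) ^ (2 * m)"
      \<comment> \<open>After the head the denominator is q itself, with divisor count D^1, hence
        \<open>i = 1\<close>; the budget is 1 + 2 m = k.\<close>
      unfolding B_def using assms D d
      by (intro mult_left_mono sum_path_cost_le[where i = 1]) auto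
    also have "\<dots> \<le> 1 / (real n * real (snd x)) * E (snd x)"
      unfolding E_def using floor_log_le_ln[of Q] assms
      by (intro mult_left_mono power_mono mult_right_mono) auto
    finally show "(\<Sum>ys | set ys \<subseteq> B x \<and> length ys = 2 * m. 1 / path_cost n 0 (x # ys))
        \<le> 1 / (real n * real (snd x)) * E (snd x)" .
  qed simp
  also have "\<dots> \<le> ?T * (\<Sum>x\<in>{- int n..int n} \<times> {1..Q}. 1 / (real n * real (snd x)) * E (snd x))"
    by (intro mult_left_mono sum_mono2 reduced_fracs_subset) (auto simp: E0)
  also have "(\<Sum>x\<in>{- int n..int n} \<times> {1..Q}. 1 / (real n * real (snd x)) * E (snd x))
      = (\<Sum>a\<in>{- int n..int n}. \<Sum>q=1..Q. 1 / (real n * real q) * E q)"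
    by (subst sum.cartesian_product) (simp add: case_prod_unfold)
  also have "\<dots> = (2 * real n + 1) / real n * (\<Sum>q=1..Q. E q / real q)"
    by (simp add: sum_distrib_left)
  also have "(\<Sum>q=1..Q. E q / real q) = (18 * ?l) ^ (2 * m) * (\<Sum>q=1..Q. real (ndivs q) ^ (4 * m * k) / real q)"
    by (simp add: E_eq sum_distrib_left)
  \<comment> \<open>The 3 bounds (2 n + 1) / n, from the 2 n + 1 numerators of the head.\<close>
  also have "?T * ((2 * real n + 1) / real n * ((18 * ?l) ^ (2 * m) * (\<Sum>q=1..Q. real (ndivs q) ^ (4 * m * k) / real q)))
      \<le> ?T * (3 * ((18 * ?l) ^ (2 * m) * ?l ^ (2 ^ (4 * m * k))))"
    using assms l1 sum_ndivs_power_le[of Q "4 * m * k"]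
    by (intro mult_left_mono mult_mono) (auto simp: divide_le_eq intro!: sum_nonneg mult_nonneg_nonneg zero_le_power)
  also have "\<dots> = 3 * 18 ^ (2 * m) * ?l ^ (2 * m + 2 ^ (4 * m * k)) * real n ^ (m + 1) * real Q ^ m"
    by (simp only: power_mult_distrib power_add mult_ac)
  finally show ?thesis .
qed

text \<open>Some index j attains the maximal divisor count. For fixed j, moving entry j to the front
  is injective into the closed lists; the union over j costs the factor k.\<close>

lemma card_integral_sum_tuples_le:
  assumes "k \<ge> 1"
  shows "card (integral_sum_tuples k (int n) (int Q)) \<le> k * card (closed_paths k n Q)"
proof -
  let ?T = "integral_sum_tuples k (int n) (int Q)"
  define idx where "idx j = j # remove1 j [1..<Suc k]" for j
  define F where "F j x = map (\<lambda>i. (fst x i, nat (snd x i))) (idx j)" for j and x :: "(nat \<Rightarrow> int) \<times> (nat \<Rightarrow> int)"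
  define T where "T j = {x \<in> ?T. \<forall>i\<in>{1..k}. ndivs (nat (snd x i)) \<le> ndivs (nat (snd x j))}" for j
  have set_is: "set (idx j) = {1..k}" "distinct (idx j)" "length (idx j) = k" if "j \<in> {1..k}" for j
    using that by (auto simp: idx_def set_remove1_eq distinct_remove1 length_remove1 simp del: upt_Suc)
  have card_T: "card (T j) \<le> card (closed_paths k n Q)" if j: "j \<in> {1..k}" for j
  proof (rule card_inj_on_le)
    show "inj_on (F j) (T j)"
    proof (rule inj_onI)
      fix x y assume xy: "x \<in> T j" "y \<in> T j" "F j x = F j y"
      obtain a q b r where x: "x = (a, q)" and y: "y = (b, r)" by fastforce
      have "a i = b i \<and> q i = r i" for i
      proof (cases "i \<in> {1..k}")
        case True
        then have "a i = b i" "nat (q i) = nat (r i)"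
          using xy(3) set_is(1)[OF j] by (auto simp: F_def x y)
        moreover have "q i \<ge> 1" "r i \<ge> 1"
          using xy(1,2) True by (auto simp: T_def x y integral_sum_tuples_def)
        ultimately show ?thesis by simp
      next
        \<comment> \<open>Outside {1..k} extensionality makes all functions
          \<open>undefined\<close>.\<close>
        case False
        then show ?thesis
          using xy(1,2) by (auto simp: T_def x y integral_sum_tuples_def PiE_iff extensional_def)
      qed
      then show "x = y" by (auto simp: x y)
    qed
    show "F j ` T j \<subseteq> closed_paths k n Q"
    proof safe
      fix a q assume aq: "(a, q) \<in> T j"
      have i: "1 \<le> q i" "q i \<le> int Q" "\<bar>a i\<bar> \<le> int n" "coprime (a i) (q i)" if "i \<in> {1..k}" for i
        using aq that by (auto simp: T_def integral_sum_tuples_def coprime_iff_gcd_eq_1)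
      let ?v = "\<lambda>i. frac_val (a i, nat (q i))"
      have "sum_list (map frac_val (F j (a, q))) = sum_list (map ?v (idx j))"
        by (simp add: F_def comp_def)
      also have "\<dots> = (\<Sum>i=1..k. ?v i)"
        using set_is[OF j] by (simp add: sum_list_distinct_conv_sum_set)
      finally have sum_eq: "sum_list (map frac_val (F j (a, q))) = (\<Sum>i=1..k. ?v i)" .
      \<comment> \<open>Integrality is given over the reals but needed over the rationals; it
        transfers because \<open>of_rat\<close> is injective.\<close>
      have "real_of_rat (\<Sum>i=1..k. ?v i) = (\<Sum>i=1..k. real_of_int (a i) / real_of_int (q i))"
        unfolding of_rat_sum using i by (intro sum.cong) (force simp: frac_val_def of_rat_divide)+
      also have "\<dots> \<in> \<int>" using aq by (simp add: T_def integral_sum_tuples_def)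
      finally obtain z where "real_of_rat (\<Sum>i=1..k. ?v i) = of_int z" by (auto elim: Ints_cases)
      then have "real_of_rat (\<Sum>i=1..k. ?v i) = real_of_rat (of_int z)" by simp
      then have "(\<Sum>i=1..k. ?v i) = of_int z" by (simp only: of_rat_eq_iff)
      then have "sum_list (map frac_val (F j (a, q))) \<in> \<int>" unfolding sum_eq by simp
      moreover have "set (F j (a, q)) \<subseteq> reduced_fracs n Q"
      proof
        fix x assume "x \<in> set (F j (a, q))"
        then obtain t where t: "t \<in> {1..k}" "x = (a t, nat (q t))"
          using set_is(1)[OF j] by (auto simp: F_def)
        then show "x \<in> reduced_fracs n Q" using i[of t] by (auto simp: reduced_fracs_def nat_le_iff)
      qed
      moreover have "\<forall>x\<in>set (F j (a, q)). ndivs (snd x) \<le> ndivs (snd (hd (F j (a, q))))"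
        using aq set_is(1)[OF j] by (auto simp: T_def F_def idx_def)
      moreover have "length (F j (a, q)) = k" using set_is(3)[OF j] by (simp add: F_def)
      ultimately show "F j (a, q) \<in> closed_paths k n Q" by (simp add: closed_paths_def)
    qed
  qed (rule finite_closed_paths)
  have "?T \<subseteq> (\<Union>j\<in>{1..k}. T j)"
  proof
    fix x assume x: "x \<in> ?T"
    let ?f = "\<lambda>i. ndivs (nat (snd x i))"
    have "Max (?f ` {1..k}) \<in> ?f ` {1..k}" using assms by (intro Max_in) auto
    then obtain j where j: "j \<in> {1..k}" "?f j = Max (?f ` {1..k})" by auto
    then have "\<forall>i\<in>{1..k}. ?f i \<le> ?f j" by simp
    then show "x \<in> (\<Union>j\<in>{1..k}. T j)" using x j(1) by (auto simp: T_def)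
  qed
  then have "card ?T \<le> card (\<Union>j\<in>{1..k}. T j)"
    by (rule card_mono[rotated]) (simp add: T_def finite_integral_sum_tuples)
  also have "\<dots> \<le> (\<Sum>j=1..k. card (T j))" by (rule card_UN_le) simp
  also have "\<dots> \<le> (\<Sum>j=1..k. card (closed_paths k n Q))" by (rule sum_mono) (rule card_T)
  finally show ?thesis by simp
qed

text \<open>The exponent e \<le> A may vary with n and Q: at Q = 1 the logarithm vanishes while
  tuples exist, so only e = 0 works there.\<close>

theorem theorem1p3:
  fixes k :: nat
  assumes "k \<ge> 3" and "odd k"
  shows "\<exists>(C::real) (A::nat). \<forall>(n::int) (Q::int). 1 \<le> n \<and> n \<le> Q \<longrightarrow>
           (\<exists>e\<le>A. real (card (integral_sum_tuples k n Q))
              \<le> C * ln (real_of_int Q) ^ e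
                  * real_of_int n ^ ((k + 1) div 2) * real_of_int Q ^ ((k - 1) div 2))"
proof -
  from \<open>odd k\<close> obtain m where k: "k = 2 * m + 1" by (elim oddE)
  define A where "A = 2 * m + 2 ^ (4 * m * k)"
  \<comment> \<open>The factor 2^A comes from 1 + L \<le> 2 max(1, L), with L the logarithm of
    Q.\<close>
  define C where "C = real k * (3 * 18 ^ (2 * m)) * 2 ^ A"
  have exps: "(k + 1) div 2 = m + 1" "(k - 1) div 2 = m" by (simp_all add: k)
  have "\<exists>e\<le>A. real (card (integral_sum_tuples k n Q))
      \<le> C * ln (real_of_int Q) ^ e * real_of_int n ^ (m + 1) * real_of_int Q ^ m"
    if nQ: "1 \<le> n" "n \<le> Q" for n Q :: int
  proof -
    define L T where "L = ln (real_of_int Q)" and "T = real_of_int n ^ (m + 1) * real_of_int Q ^ m"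
    have L: "L \<ge> 0" using nQ by (simp add: L_def)
    have T: "T \<ge> 0" using nQ by (simp add: T_def)
    have "real (card (integral_sum_tuples k n Q)) \<le> real k * real (card (closed_paths k (nat n) (nat Q)))"
    proof -
      have "card (integral_sum_tuples k n Q) \<le> k * card (closed_paths k (nat n) (nat Q))"
        using card_integral_sum_tuples_le[of k "nat n" "nat Q"] nQ assms(1) by simp
      then show ?thesis by (simp only: of_nat_le_iff flip: of_nat_mult)
    qed
    also have "\<dots> \<le> real k * (3 * 18 ^ (2 * m) * (1 + L) ^ A * T)"
      using card_closed_paths_le[of "nat n" "nat Q" k m] nQ k
      by (intro mult_left_mono) (auto simp: A_def L_def T_def mult.assoc)
    finally have bound: "real (card (integral_sum_tuples k n Q)) \<le> real k * (3 * 18 ^ (2 * m)) * ((1 + L) ^ A * T)"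
      by (simp add: mult_ac)
    \<comment> \<open>The exponent \<open>e = 0\<close> serves the \<open>Q\<close> for which \<open>ln Q\<close> is less than \<open>1\<close>.\<close>
    define e where "e = (if L \<le> 1 then 0 else A)"
    have "(1 + L) ^ A \<le> 2 ^ A * L ^ e"
    proof (cases "L \<le> 1")
      case True
      then show ?thesis using L power_mono[of "1 + L" 2 A] by (simp add: e_def)
    next
      case False
      then show ?thesis using power_mono[of "1 + L" "2 * L" A] by (simp add: e_def power_mult_distrib)
    qed
    then have "(1 + L) ^ A * T \<le> 2 ^ A * L ^ e * T" using T by (rule mult_right_mono)
    then have "real k * (3 * 18 ^ (2 * m)) * ((1 + L) ^ A * T) \<le> real k * (3 * 18 ^ (2 * m)) * (2 ^ A * L ^ e * T)"
      by (rule mult_left_mono) simp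
    with bound have "real (card (integral_sum_tuples k n Q)) \<le> C * L ^ e * T"
      by (simp add: C_def mult_ac)
    then show ?thesis
      unfolding L_def T_def by (intro exI[of _ e]) (simp add: e_def mult.assoc)
  qed
  then show ?thesis unfolding exps by blast
qed

end
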